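(* Let $n,m\in\mathbb{N}_0$ with $n\ge m$, and let $\kappa\in\mathbb{R}$ with $|\kappa|>0$. Define $c_0=1$ and \[ c_j=\prod_{k=m}^{m+j-1}\frac{i(n-k)}{n+k+1},\qquad j>0 . \] Then \[ I_2(n,m,\kappa,t)=e^{i\kappa t}t^{n+1}\sum_{j=m}^{n}\frac{c_{j-m}}{n+j+1}\left(J_{j,\kappa}(t)-iJ_{j+1,\kappa}(t)\right). \]
   Context: $\mathbb{N}_0=\{0,1,2,\dots\}$ and $i$ is the imaginary unit. $J_m$ is the Bessel function of the first kind of integer order $m$, and $J_{m,\kappa}(t):=J_m(\kappa t)$ for real $t$. $I_2(n,m,\kappa,t):=\int t^nJ_{m,\kappa}(t)e^{i\kappa t}\,dt$ denotes the indefinite integral (an antiderivative in $t$ of $t^nJ_m(\kappa t)e^{i\kappa t}$); identities between indefinite integrals are understood up to an additive constant. *)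

theory Defs
  imports "HOL-Analysis.Analysis"
begin

(* Power series of the Bessel function of the first kind. Only nonnegative integer
   orders are covered, so Gamma(k + m + 1) is (k + m)!. *)
definition bessel_J :: "nat \<Rightarrow> real \<Rightarrow> real" where
  "bessel_J m x = (\<Sum>k. (-1) ^ k / (fact k * fact (k + m)) * (x / 2) ^ (2 * k + m))"

definition bessel_J_scaled :: "nat \<Rightarrow> real \<Rightarrow> real \<Rightarrow> real" where
  "bessel_J_scaled m \<kappa> t = bessel_J m (\<kappa> * t)"

(* The indefinite integral of f is the set of all its antiderivatives on the real line,
   so that "F is the indefinite integral of f, up to an additive constant" reads
   indefinite_integral f = up_to_constant F. *)
definition indefinite_integral :: "(real \<Rightarrow> complex) \<Rightarrow> (real \<Rightarrow> complex) set" where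
  "indefinite_integral f = {F. \<forall>t. (F has_vector_derivative f t) (at t)}"

definition up_to_constant :: "(real \<Rightarrow> complex) \<Rightarrow> (real \<Rightarrow> complex) set" where
  "up_to_constant F = {\<lambda>t. F t + C | C. True}"

definition I2 :: "nat \<Rightarrow> nat \<Rightarrow> real \<Rightarrow> (real \<Rightarrow> complex) set" where
  "I2 n m \<kappa> = indefinite_integral
     (\<lambda>t. of_real (t ^ n * bessel_J_scaled m \<kappa> t) * exp (\<i> * of_real (\<kappa> * t)))"

(* For j = 0 the product is empty, which gives the convention c_0 = 1. *)
definition c_coeff :: "nat \<Rightarrow> nat \<Rightarrow> nat \<Rightarrow> complex" where
  "c_coeff n m j =
     (\<Prod>k\<in>{m..<m + j}. \<i> * (of_nat n - of_nat k) / (of_nat n + of_nat k + 1))"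

end

theory Submission
  imports Defs
begin

text \<open>
  Write \<open>G\<^sub>j t = e\<^sup>i\<^sup>\<kappa>\<^sup>t t\<^sup>n\<^sup>+\<^sup>1 (J\<^sub>j (\<kappa> t) - \<i> J\<^sub>j\<^sub>+\<^sub>1 (\<kappa> t))\<close> for the building block of
  the right-hand side. The Bessel relations \<open>x J\<^sub>j' = j J\<^sub>j - x J\<^sub>j\<^sub>+\<^sub>1\<close> and
  \<open>x J\<^sub>j\<^sub>+\<^sub>1' = x J\<^sub>j - (j + 1) J\<^sub>j\<^sub>+\<^sub>1\<close> hold with the same two functions on the right, and in the
  derivative of \<open>G\<^sub>j\<close> all terms carrying the factor \<open>x = \<kappa> t\<close> cancel against
  the derivative of the exponential; what remains
  (\<open>bessel_block_has_vector_derivative\<close>) is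
  \<open>e\<^sup>i\<^sup>\<kappa>\<^sup>t t\<^sup>n ((n + j + 1) J\<^sub>j - \<i> (n - j) J\<^sub>j\<^sub>+\<^sub>1)\<close>.
  After division by \<open>n + j + 1\<close>, the coefficient of \<open>J\<^sub>j\<^sub>+\<^sub>1\<close> is minus the factor by which
  \<open>c\<close> grows from one index to the next. Hence the sum weighted with the \<open>c\<close>'s telescopes
  to \<open>e\<^sup>i\<^sup>\<kappa>\<^sup>t t\<^sup>n\<close> times \<open>J\<^sub>m - c\<^sub>n\<^sub>+\<^sub>1\<^sub>-\<^sub>m J\<^sub>n\<^sub>+\<^sub>1\<close> (\<open>c_coeff_telescope\<close>), and the last
  coefficient vanishes because its product contains the factor with \<open>k = n\<close>.

  The Bessel relations come from \<open>J\<^sub>m x = (x/2)\<^sup>m g\<^sub>m (x\<^sup>2/4)\<close> with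
  \<open>g\<^sub>m y = (\<Sum>k. (-y)\<^sup>k / (k! (k + m)!))\<close>, for which \<open>g\<^sub>m' = - g\<^sub>m\<^sub>+\<^sub>1\<close> is immediate from the
  coefficients. Finally, two antiderivatives on the whole line differ by a constant.
\<close>

section \<open>The Bessel power series\<close>

definition bessel_coeff :: "nat \<Rightarrow> nat \<Rightarrow> real" where
  "bessel_coeff m k = (-1) ^ k / (fact k * fact (k + m))"

text \<open>The Bessel--Clifford function, up to the sign of the argument.\<close>

definition bessel_clifford :: "nat \<Rightarrow> real \<Rightarrow> real" where
  "bessel_clifford m y = (\<Sum>k. bessel_coeff m k * y ^ k)"

lemma summable_bessel_coeff: "summable (\<lambda>k. bessel_coeff m k * y ^ k)"
proof (rule summable_comparison_test')
  show "summable (\<lambda>k. inverse (fact k) * \<bar>y\<bar> ^ k)"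
    by (rule summable_exp)
  fix k :: nat
  have "1 * fact k \<le> fact (k + m) * (fact k :: real)"
    by (intro mult_right_mono) auto
  then have "1 / (fact k * fact (k + m)) \<le> (1 / fact k :: real)"
    by (intro divide_left_mono) (auto simp: mult.commute)
  then show "norm (bessel_coeff m k * y ^ k) \<le> inverse (fact k) * \<bar>y\<bar> ^ k"
    using mult_right_mono[of _ _ "\<bar>y\<bar> ^ k"]
    by (fastforce simp: bessel_coeff_def abs_mult power_abs inverse_eq_divide)
qed

lemma diffs_bessel_coeff: "diffs (bessel_coeff m) = (\<lambda>k. - bessel_coeff (Suc m) k)"
  by (rule ext) (simp add: diffs_def bessel_coeff_def divide_simps)

lemma bessel_clifford_has_real_derivative:
  "(bessel_clifford m has_real_derivative - bessel_clifford (Suc m) y) (at y)"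
proof -
  have "((\<lambda>y. \<Sum>k. bessel_coeff m k * y ^ k) has_real_derivative
          (\<Sum>k. diffs (bessel_coeff m) k * y ^ k)) (at y)"
    by (rule termdiffs_strong_converges_everywhere) (rule summable_bessel_coeff)
  also have "(\<Sum>k. diffs (bessel_coeff m) k * y ^ k) = - bessel_clifford (Suc m) y"
    by (simp add: diffs_bessel_coeff bessel_clifford_def
        suminf_minus[OF summable_bessel_coeff])
  finally show ?thesis
    by (simp add: bessel_clifford_def[abs_def])
qed

text \<open>
  Since \<open>k + m + 1\<close> times the \<open>k\<close>-th coefficient of order \<open>m + 1\<close> is the \<open>k\<close>-th coefficient of order
  \<open>m\<close>, one has \<open>(m + 1) g\<^sub>m\<^sub>+\<^sub>1 + y g\<^sub>m\<^sub>+\<^sub>1' = g\<^sub>m\<close>; below, \<open>g\<^sub>m\<^sub>+\<^sub>1'\<close> is written as \<open>- g\<^sub>m\<^sub>+\<^sub>2\<close>.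
\<close>

lemma bessel_clifford_recurrence:
  "bessel_clifford m y + y * bessel_clifford (Suc (Suc m)) y
     = (real m + 1) * bessel_clifford (Suc m) y"
proof -
  let ?f = "\<lambda>k. (real m + 1) * (bessel_coeff (Suc m) k * y ^ k) - bessel_coeff m k * y ^ k"
  have "(real m + 1) * bessel_coeff (Suc m) 0 = bessel_coeff m 0"
    by (simp add: bessel_coeff_def add.commute[of 1] add_nonneg_eq_0_iff)
  then have f0: "?f 0 = 0"
    by simp
  have fSuc: "?f (Suc k) = y * (bessel_coeff (Suc (Suc m)) k * y ^ k)" for k
  proof -
    have 1: "bessel_coeff m (Suc k) = (real k + real m + 2) * bessel_coeff (Suc m) (Suc k)"
      by (simp add: bessel_coeff_def divide_simps)
    have 2: "(real k + 1) * bessel_coeff (Suc m) (Suc k) = - bessel_coeff (Suc (Suc m)) k"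
      by (simp add: bessel_coeff_def divide_simps)
    have "?f (Suc k) = - ((real k + 1) * bessel_coeff (Suc m) (Suc k)) * (y * y ^ k)"
      unfolding 1 by (simp add: algebra_simps)
    then show ?thesis
      unfolding 2 by simp
  qed
  have "(real m + 1) * bessel_clifford (Suc m) y - bessel_clifford m y = suminf ?f"
    unfolding bessel_clifford_def
    using suminf_diff[OF summable_mult[OF summable_bessel_coeff] summable_bessel_coeff]
      suminf_mult[OF summable_bessel_coeff] by metis
  also have "\<dots> = (\<Sum>k. ?f (Suc k))"
    using f0 by (subst suminf_split_head)
      (auto intro!: summable_diff summable_mult summable_bessel_coeff)
  also have "\<dots> = y * bessel_clifford (Suc (Suc m)) y"
    unfolding fSuc bessel_clifford_def by (simp add: suminf_mult summable_bessel_coeff)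
  finally show ?thesis
    by simp
qed

lemma bessel_J_eq_clifford: "bessel_J m x = (x / 2) ^ m * bessel_clifford m ((x / 2)\<^sup>2)"
  unfolding bessel_clifford_def
  by (subst suminf_mult[OF summable_bessel_coeff, symmetric])
     (simp add: bessel_J_def bessel_coeff_def power_add power_mult mult.commute mult.left_commute
        flip: power_mult)

section \<open>Differential and recurrence relations of the Bessel functions\<close>

lemma bessel_J_recurrence:
  "x * (bessel_J m x + bessel_J (Suc (Suc m)) x) = 2 * (real m + 1) * bessel_J (Suc m) x"
proof -
  have "x * (bessel_J m x + bessel_J (Suc (Suc m)) x)
      = 2 * (x / 2) ^ Suc m *
          (bessel_clifford m ((x / 2)\<^sup>2) + (x / 2)\<^sup>2 * bessel_clifford (Suc (Suc m)) ((x / 2)\<^sup>2))"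
    by (simp add: bessel_J_eq_clifford algebra_simps power2_eq_square)
  then show ?thesis
    by (simp only: bessel_clifford_recurrence bessel_J_eq_clifford mult_ac)
qed

text \<open>
  The derivative is multiplied by \<open>x\<close> so that the relation also makes sense at \<open>x = 0\<close>,
  which has to be covered because antiderivatives are taken on the whole line.
\<close>

lemma bessel_J_has_real_derivative:
  obtains D where "(bessel_J m has_real_derivative D) (at x)"
    and "x * D = real m * bessel_J m x - x * bessel_J (Suc m) x"
proof
  \<comment> \<open>For \<open>m = 0\<close> the exponent is truncated, but the factor \<open>real m\<close> removes that term.\<close>
  let ?D = "real m * (x / 2) ^ (m - 1) / 2 * bessel_clifford m ((x / 2)\<^sup>2)
      - (x / 2) ^ m * (x / 2) * bessel_clifford (Suc m) ((x / 2)\<^sup>2)"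
  have "((\<lambda>x. (x / 2)\<^sup>2) has_real_derivative x / 2) (at x)"
    by (auto intro!: derivative_eq_intros)
  then have "((\<lambda>x. bessel_clifford m ((x / 2)\<^sup>2)) has_real_derivative
      - bessel_clifford (Suc m) ((x / 2)\<^sup>2) * (x / 2)) (at x)"
    by (rule DERIV_chain2[OF bessel_clifford_has_real_derivative])
  moreover have "((\<lambda>x. (x / 2) ^ m) has_real_derivative real m * (x / 2) ^ (m - 1) / 2) (at x)"
    by (auto intro!: derivative_eq_intros)
  ultimately have "((\<lambda>x. (x / 2) ^ m * bessel_clifford m ((x / 2)\<^sup>2)) has_real_derivative ?D) (at x)"
    by (auto intro!: derivative_eq_intros simp: algebra_simps)
  then show "(bessel_J m has_real_derivative ?D) (at x)"
    by (simp add: bessel_J_eq_clifford[abs_def])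
  show "x * ?D = real m * bessel_J m x - x * bessel_J (Suc m) x"
    by (cases m) (simp_all add: bessel_J_eq_clifford algebra_simps)
qed

section \<open>The telescoping sum\<close>

text \<open>
  The first relation is used for \<open>J\<^sub>j\<close>; for \<open>J\<^sub>j\<^sub>+\<^sub>1\<close> the recurrence trades \<open>J\<^sub>j\<^sub>+\<^sub>2\<close> for
  \<open>J\<^sub>j\<close>, so that only \<open>J\<^sub>j\<close> and \<open>J\<^sub>j\<^sub>+\<^sub>1\<close> occur. The factor \<open>t\<^sup>n\<^sup>+\<^sup>1\<close> supplies the \<open>t\<close> that
  turns \<open>\<kappa> J\<^sub>j' (\<kappa> t)\<close> into \<open>x J\<^sub>j' x\<close> with \<open>x = \<kappa> t\<close>.
\<close>

lemma bessel_block_has_vector_derivative: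
  "((\<lambda>t. exp (\<i> * of_real (\<kappa> * t)) * of_real t ^ (n + 1) *
       (of_real (bessel_J_scaled j \<kappa> t) - \<i> * of_real (bessel_J_scaled (j + 1) \<kappa> t)))
    has_vector_derivative
     exp (\<i> * of_real (\<kappa> * t)) * of_real t ^ n *
       ((of_nat n + of_nat j + 1) * of_real (bessel_J_scaled j \<kappa> t)
         - \<i> * (of_nat n - of_nat j) * of_real (bessel_J_scaled (j + 1) \<kappa> t)))
    (at t)"
proof -
  define x where "x = \<kappa> * t"
  obtain A where A: "(bessel_J j has_real_derivative A) (at x)"
      and xA: "x * A = real j * bessel_J j x - x * bessel_J (Suc j) x"
    by (rule bessel_J_has_real_derivative)
  obtain B where B: "(bessel_J (Suc j) has_real_derivative B) (at x)"
      and "x * B = real (Suc j) * bessel_J (Suc j) x - x * bessel_J (Suc (Suc j)) x"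
    by (rule bessel_J_has_real_derivative)
  then have xB: "x * B = x * bessel_J j x - (real j + 1) * bessel_J (Suc j) x"
    using bessel_J_recurrence[of x j] by (simp add: algebra_simps)
  have dJ: "((\<lambda>t. complex_of_real (bessel_J_scaled j \<kappa> t)) has_vector_derivative of_real (A * \<kappa>)) (at t)"
    unfolding bessel_J_scaled_def
    by (rule has_vector_derivative_of_real DERIV_chain2[where g = "\<lambda>t. \<kappa> * t", OF A[unfolded x_def]])+
       (auto intro!: derivative_eq_intros)
  have dJ': "((\<lambda>t. complex_of_real (bessel_J_scaled (j + 1) \<kappa> t)) has_vector_derivative of_real (B * \<kappa>)) (at t)"
    unfolding bessel_J_scaled_def Suc_eq_plus1[symmetric]
    by (rule has_vector_derivative_of_real DERIV_chain2[where g = "\<lambda>t. \<kappa> * t", OF B[unfolded x_def]])+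
       (auto intro!: derivative_eq_intros)
  have dE: "((\<lambda>t. exp (\<i> * of_real (\<kappa> * t)) * of_real t ^ (n + 1)) has_vector_derivative
      exp (\<i> * of_real x) * of_real t ^ n * (of_nat n + 1 + \<i> * of_real x)) (at t)"
  proof -
    have "((\<lambda>z. exp (\<i> * (of_real \<kappa> * z)) * z ^ (n + 1)) has_field_derivative
      exp (\<i> * of_real x) * of_real t ^ n * (of_nat n + 1 + \<i> * of_real x)) (at (complex_of_real t))"
      by (rule derivative_eq_intros refl)+ (simp add: x_def algebra_simps)
    from has_vector_derivative_real_field[OF this] show ?thesis
      by simp
  qed
  let ?J = "complex_of_real (bessel_J j x)" and ?J' = "complex_of_real (bessel_J (Suc j) x)"
  have xA': "of_real x * of_real A = of_nat j * ?J - of_real x * ?J'"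
    using arg_cong[OF xA, of complex_of_real] by simp
  have xB': "of_real x * of_real B = of_real x * ?J - (of_nat j + 1) * ?J'"
    using arg_cong[OF xB, of complex_of_real] by simp
  let ?E = "exp (\<i> * of_real x) * complex_of_real t ^ n"
  have "?E * of_real t * (of_real (A * \<kappa>) - \<i> * of_real (B * \<kappa>))
      + ?E * (of_nat n + 1 + \<i> * of_real x) * (?J - \<i> * ?J')
      = ?E * (of_real x * of_real A - \<i> * (of_real x * of_real B)
              + (of_nat n + 1 + \<i> * of_real x) * (?J - \<i> * ?J'))"
    by (simp add: x_def algebra_simps)
  also have "\<dots> = ?E * ((of_nat n + of_nat j + 1) * ?J - \<i> * (of_nat n - of_nat j) * ?J')"
    unfolding xA' xB' by (simp add: algebra_simps)
  finally have eq: "?E * of_real t * (of_real (A * \<kappa>) - \<i> * of_real (B * \<kappa>))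
      + ?E * (of_nat n + 1 + \<i> * of_real x) * (?J - \<i> * ?J')
      = ?E * ((of_nat n + of_nat j + 1) * ?J - \<i> * (of_nat n - of_nat j) * ?J')" .
  show ?thesis
    by (rule has_vector_derivative_eq_rhs[OF has_vector_derivative_mult[OF dE
          has_vector_derivative_diff[OF dJ has_vector_derivative_mult_right[OF dJ']]]])
       (use eq in \<open>simp add: bessel_J_scaled_def x_def mult_ac\<close>)
qed

lemma c_coeff_Suc:
  "c_coeff n m (Suc j) =
     c_coeff n m j * (\<i> * (of_nat n - of_nat (m + j)) / (of_nat n + of_nat (m + j) + 1))"
  by (simp add: c_coeff_def)

lemma of_nat_add_of_nat_add_1_neq_0: "of_nat n + of_nat j + 1 \<noteq> (0 :: complex)"
  by (metis Suc_eq_plus1 of_nat_1 of_nat_add of_nat_eq_0_iff Zero_not_Suc)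

text \<open>
  Each summand is \<open>c\<^sub>j\<^sub>-\<^sub>m f\<^sub>j - c\<^sub>j\<^sub>+\<^sub>1\<^sub>-\<^sub>m f\<^sub>j\<^sub>+\<^sub>1\<close>, and the upper boundary term
  \<open>c\<^sub>n\<^sub>+\<^sub>1\<^sub>-\<^sub>m f\<^sub>n\<^sub>+\<^sub>1\<close> is zero.
\<close>

lemma c_coeff_telescope:
  assumes "m \<le> n"
  shows "(\<Sum>j = m..n. c_coeff n m (j - m) / (of_nat n + of_nat j + 1) *
            ((of_nat n + of_nat j + 1) * f j - \<i> * (of_nat n - of_nat j) * f (j + 1))) = f m"
proof -
  let ?h = "\<lambda>j. c_coeff n m (j - m) * f j"
  have "(\<Sum>j = m..n. c_coeff n m (j - m) / (of_nat n + of_nat j + 1) *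
            ((of_nat n + of_nat j + 1) * f j - \<i> * (of_nat n - of_nat j) * f (j + 1)))
      = (\<Sum>j = m..n. ?h j - ?h (Suc j))"
  proof (rule sum.cong)
    fix j assume "j \<in> {m..n}"
    then have c: "c_coeff n m (Suc j - m) =
        c_coeff n m (j - m) * (\<i> * (of_nat n - of_nat j) / (of_nat n + of_nat j + 1))"
      using c_coeff_Suc[of n m "j - m"] by (simp add: Suc_diff_le)
    have "w / d * (d * a - u * b) = w * a - w * (u / d) * b"
      if "d \<noteq> 0" for w d u a b :: complex
      using that by (simp add: field_simps)
    from this[OF of_nat_add_of_nat_add_1_neq_0]
    show "c_coeff n m (j - m) / (of_nat n + of_nat j + 1) *
            ((of_nat n + of_nat j + 1) * f j - \<i> * (of_nat n - of_nat j) * f (j + 1))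
        = ?h j - ?h (Suc j)"
      by (simp only: c Suc_eq_plus1[symmetric])
  qed simp
  also have "\<dots> = ?h m - ?h (Suc n)"
    using assms sum_Suc_diff[of m n "\<lambda>j. - ?h j"] by simp
  also have "c_coeff n m (Suc n - m) = 0"
    using assms c_coeff_Suc[of n m "n - m"] by (simp add: Suc_diff_le)
  finally show ?thesis
    by (simp add: c_coeff_def)
qed

section \<open>The indefinite integral\<close>

lemma indefinite_integral_eq_up_to_constant:
  assumes F: "\<And>t. (F has_vector_derivative f t) (at t)"
  shows "indefinite_integral f = up_to_constant F"
proof (intro equalityI subsetI)
  fix G assume "G \<in> indefinite_integral f"
  then have G: "(G has_vector_derivative f t) (at t)" for t
    by (simp add: indefinite_integral_def)
  have "((\<lambda>t. G t - F t) has_vector_derivative 0) (at t)" for t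
    using has_vector_derivative_diff[OF G F] by simp
  then obtain C where "\<And>t. G t - F t = C"
    using has_vector_derivative_zero_constant[of UNIV "\<lambda>t. G t - F t"] by auto
  then have "G = (\<lambda>t. F t + C)"
    by (metis add.commute diff_add_cancel)
  then show "G \<in> up_to_constant F"
    by (auto simp: up_to_constant_def)
next
  fix G assume "G \<in> up_to_constant F"
  then obtain C where "G = (\<lambda>t. F t + C)"
    by (auto simp: up_to_constant_def)
  then show "G \<in> indefinite_integral f"
    using F by (simp add: indefinite_integral_def has_vector_derivative_add_const)
qed

theorem proposition3p2:
  fixes n m :: nat and \<kappa> :: real
  assumes "n \<ge> m" and "\<bar>\<kappa>\<bar> > 0"
  shows "I2 n m \<kappa> = up_to_constant (\<lambda>t.
    exp (\<i> * of_real (\<kappa> * t)) * of_real t ^ (n + 1) *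
    (\<Sum>j = m..n. c_coeff n m (j - m) / (of_nat n + of_nat j + 1) *
       (of_real (bessel_J_scaled j \<kappa> t) - \<i> * of_real (bessel_J_scaled (j + 1) \<kappa> t))))"
  unfolding I2_def
proof (rule indefinite_integral_eq_up_to_constant)
  fix t :: real
  let ?w = "\<lambda>j. c_coeff n m (j - m) / (of_nat n + of_nat j + 1)"
  let ?J = "\<lambda>j t. complex_of_real (bessel_J_scaled j \<kappa> t)"
  let ?E = "\<lambda>t. exp (\<i> * of_real (\<kappa> * t))"
  have "((\<lambda>t. \<Sum>j = m..n. ?w j * (?E t * of_real t ^ (n + 1) * (?J j t - \<i> * ?J (j + 1) t)))
     has_vector_derivative
      (\<Sum>j = m..n. ?w j * (?E t * of_real t ^ n *
         ((of_nat n + of_nat j + 1) * ?J j t - \<i> * (of_nat n - of_nat j) * ?J (j + 1) t)))) (at t)"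
    by (intro has_vector_derivative_sum has_vector_derivative_mult_right
        bessel_block_has_vector_derivative)
  also have "(\<lambda>t. \<Sum>j = m..n. ?w j * (?E t * of_real t ^ (n + 1) * (?J j t - \<i> * ?J (j + 1) t)))
      = (\<lambda>t. ?E t * of_real t ^ (n + 1) * (\<Sum>j = m..n. ?w j * (?J j t - \<i> * ?J (j + 1) t)))"
    unfolding sum_distrib_left by (intro ext sum.cong refl mult.left_commute)
  also have "(\<Sum>j = m..n. ?w j * (?E t * of_real t ^ n *
         ((of_nat n + of_nat j + 1) * ?J j t - \<i> * (of_nat n - of_nat j) * ?J (j + 1) t)))
      = ?E t * of_real t ^ n * (\<Sum>j = m..n. ?w j *
         ((of_nat n + of_nat j + 1) * ?J j t - \<i> * (of_nat n - of_nat j) * ?J (j + 1) t))"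
    unfolding sum_distrib_left by (intro sum.cong refl mult.left_commute)
  also have "\<dots> = ?E t * of_real t ^ n * ?J m t"
    using c_coeff_telescope[OF \<open>n \<ge> m\<close>, of "\<lambda>j. ?J j t"] by simp
  also have "\<dots> = of_real (t ^ n * bessel_J_scaled m \<kappa> t) * ?E t"
    by simp
  finally show "((\<lambda>t. ?E t * of_real t ^ (n + 1) *
        (\<Sum>j = m..n. ?w j * (?J j t - \<i> * ?J (j + 1) t)))
      has_vector_derivative of_real (t ^ n * bessel_J_scaled m \<kappa> t) * ?E t) (at t)" .
qed

end
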